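(* Let $m\geq 4$ be an integer and let $G$ be an $m$-free digraph. Then $\beta(G)\leq \frac{1}{m-2}\,\gamma(G)$.
   Context: All digraphs are finite, without loops and without parallel edges. A digraph $G$ is $m$-free if it has no directed cycle of length at most $m$. A digraph is acyclic if it has no directed cycle. $\beta(G)$ denotes the minimum size of a set $X\subseteq E(G)$ of edges such that $G-X$ is acyclic. $\gamma(G)$ denotes the number of unordered pairs $\{a,b\}$ of distinct vertices of $G$ such that neither $(a,b)$ nor $(b,a)$ is an edge of $G$. *)

theory Defs
  imports Complex_Main
begin

definition digraph :: "'a set \<Rightarrow> ('a \<times> 'a) set \<Rightarrow> bool" where
  "digraph V E \<longleftrightarrow> finite V \<and> E \<subseteq> V \<times> V \<and> (\<forall>v. (v, v) \<notin> E)"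

definition is_dcycle :: "('a \<times> 'a) set \<Rightarrow> 'a list \<Rightarrow> bool" where
  "is_dcycle E vs \<longleftrightarrow> vs \<noteq> [] \<and> distinct vs \<and>
     (\<forall>i < length vs - 1. (vs ! i, vs ! (i + 1)) \<in> E) \<and>
     (last vs, hd vs) \<in> E"

definition m_free :: "nat \<Rightarrow> ('a \<times> 'a) set \<Rightarrow> bool" where
  "m_free m E \<longleftrightarrow> \<not> (\<exists>vs. is_dcycle E vs \<and> length vs \<le> m)"

definition dacyclic :: "('a \<times> 'a) set \<Rightarrow> bool" where
  "dacyclic E \<longleftrightarrow> \<not> (\<exists>vs. is_dcycle E vs)"

definition beta :: "('a \<times> 'a) set \<Rightarrow> nat" where
  "beta E = Min {card X | X. X \<subseteq> E \<and> dacyclic (E - X)}"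

definition gamma :: "'a set \<Rightarrow> ('a \<times> 'a) set \<Rightarrow> nat" where
  "gamma V E = card {{a, b} | a b. a \<in> V \<and> b \<in> V \<and> a \<noteq> b \<and>
                                    (a, b) \<notin> E \<and> (b, a) \<notin> E}"

end

theory Submission
  imports Defs
begin

text \<open>
  By induction on the number of vertices it suffices to find a nontrivial cut \<open>(S, V - S)\<close> for which
  \<open>m - 2\<close> times the number of edges from \<open>S\<close> to \<open>V - S\<close> is at most the number of nonadjacent pairs
  across it. Call \<open>(u, w, z)\<close> a geodesic triple of type \<open>(j, k)\<close> if \<open>d(u, w) = j\<close>, \<open>d(w, z) = k\<close> and
  \<open>d(u, z) = j + k\<close>. Among all types \<open>(i, 1)\<close> and \<open>(1, i)\<close> with \<open>1 \<le> i \<le> m - 2\<close> choose the rarest;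
  reversing all edges, we may assume that it is \<open>(i, 1)\<close>. A vertex \<open>w\<close> without outgoing edges yields
  the cut \<open>{w}\<close>; if there is none, average the cuts \<open>S w = {z. 1 \<le> d(w, z) \<le> i}\<close> over all vertices
  \<open>w\<close>. An edge \<open>(x, y)\<close> leaving \<open>S w\<close> makes \<open>(w, x, y)\<close>
  a geodesic triple of type \<open>(i, 1)\<close>. Conversely, since there are no short cycles, each geodesic
  triple \<open>(u, w, z)\<close> of one of the \<open>m - 2\<close> types \<open>(1, 1), \<dots>, (m - 1 - i, 1)\<close> and
  \<open>(1, 2), \<dots>, (1, i)\<close> yields a nonadjacent pair \<open>z \<in> S w\<close>, \<open>u \<notin> S w\<close>.
\<close>

definition at_dist :: "('a \<times> 'a) set \<Rightarrow> nat \<Rightarrow> ('a \<times> 'a) set" where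
  "at_dist E k = {(x, y). (x, y) \<in> E ^^ k \<and> (\<forall>j<k. (x, y) \<notin> E ^^ j)}"

definition geodesic_triples :: "('a \<times> 'a) set \<Rightarrow> nat \<Rightarrow> nat \<Rightarrow> ('a \<times> 'a \<times> 'a) set" where
  "geodesic_triples E j k =
     {(u, w, z). (u, w) \<in> at_dist E j \<and> (w, z) \<in> at_dist E k \<and> (u, z) \<in> at_dist E (j + k)}"

definition unit_leg_types :: "nat \<Rightarrow> (nat \<times> nat) set" where
  "unit_leg_types n = {1..n} \<times> {1} \<union> {1} \<times> {1..n}"

definition punctured_out_ball :: "('a \<times> 'a) set \<Rightarrow> nat \<Rightarrow> 'a \<Rightarrow> 'a set" where
  "punctured_out_ball E i w = {z. \<exists>k\<in>{1..i}. (w, z) \<in> at_dist E k}"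

definition cut_edges :: "'a set \<Rightarrow> ('a \<times> 'a) set \<Rightarrow> 'a set \<Rightarrow> ('a \<times> 'a) set" where
  "cut_edges V E S = E \<inter> S \<times> (V - S)"

definition cut_nonedges :: "'a set \<Rightarrow> ('a \<times> 'a) set \<Rightarrow> 'a set \<Rightarrow> ('a \<times> 'a) set" where
  "cut_nonedges V E S = S \<times> (V - S) - (E \<union> E\<inverse>)"

definition sparse_cut :: "nat \<Rightarrow> 'a set \<Rightarrow> ('a \<times> 'a) set \<Rightarrow> 'a set \<Rightarrow> bool" where
  "sparse_cut c V E S \<longleftrightarrow>
     S \<noteq> {} \<and> S \<subset> V \<and> c * card (cut_edges V E S) \<le> card (cut_nonedges V E S)"

definition nonadjacent_pairs :: "'a set \<Rightarrow> ('a \<times> 'a) set \<Rightarrow> 'a set set" where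
  "nonadjacent_pairs V E =
     {{a, b} | a b. a \<in> V \<and> b \<in> V \<and> a \<noteq> b \<and> (a, b) \<notin> E \<and> (b, a) \<notin> E}"

lemma digraph_finite_edges: "digraph V E \<Longrightarrow> finite E"
  unfolding digraph_def by (meson finite_SigmaI finite_subset)


subsection \<open>Cycles and closed walks\<close>

lemma is_dcycle_imp_closed_walk:
  assumes "is_dcycle E vs"
  shows "(hd vs, hd vs) \<in> E ^^ length vs"
proof -
  define f where "f i = vs ! (i mod length vs)" for i
  have nonempty: "vs \<noteq> []" using assms by (simp add: is_dcycle_def)
  have "(f i, f (Suc i)) \<in> E" if "i < length vs" for i
  proof (cases "Suc i = length vs")
    case True
    moreover from this have "i = length vs - 1" by simp
    ultimately show ?thesis
      using assms nonempty by (simp add: is_dcycle_def f_def hd_conv_nth last_conv_nth)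
  next
    case False
    then show ?thesis using assms that by (simp add: is_dcycle_def f_def)
  qed
  moreover have "f 0 = hd vs" "f (length vs) = hd vs"
    using nonempty by (simp_all add: f_def hd_conv_nth)
  ultimately show ?thesis unfolding relpow_fun_conv by blast
qed

lemma closed_injective_walk_is_dcycle:
  assumes "0 < n" and "f n = f 0" and "inj_on f {..<n}"
    and walk: "\<And>i. i < n \<Longrightarrow> (f i, f (Suc i)) \<in> E"
  shows "is_dcycle E (map f [0..<n])"
proof -
  have "(f (n - 1), f 0) \<in> E"
    using walk[of "n - 1"] assms(1,2) by simp
  then show ?thesis
    using assms by (simp add: is_dcycle_def distinct_map lessThan_atLeast0 last_map hd_map)
qed

lemma closed_walk_imp_is_dcycle:
  assumes "0 < n" and "(x, x) \<in> E ^^ n"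
  obtains vs where "is_dcycle E vs" "length vs \<le> n"
proof -
  have "\<exists>vs. is_dcycle E vs \<and> length vs \<le> n"
    using assms
  proof (induction n arbitrary: x rule: less_induct)
    case (less n)
    from less.prems(2) obtain f where f: "f 0 = x" "f n = x"
      and walk: "\<And>i. i < n \<Longrightarrow> (f i, f (Suc i)) \<in> E"
      unfolding relpow_fun_conv by blast
    show ?case
    proof (cases "inj_on f {..<n}")
      case True
      then have "is_dcycle E (map f [0..<n])"
        using less.prems(1) f walk by (simp add: closed_injective_walk_is_dcycle)
      then show ?thesis by (intro exI[of _ "map f [0..<n]"]) simp
    next
      case False
      then obtain a b where ab: "a < b" "b < n" "f a = f b"
        by (metis lessThan_iff linorder_inj_onI')
      have "(f a, f a) \<in> E ^^ (b - a)"
        unfolding relpow_fun_conv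
        using ab walk by (intro exI[of _ "\<lambda>i. f (a + i)"]) auto
      moreover have "0 < b - a" "b - a < n" using ab by auto
      ultimately obtain vs where "is_dcycle E vs" "length vs \<le> b - a"
        using less.IH by blast
      then show ?thesis using ab by (intro exI[of _ vs]) simp
    qed
  qed
  then show ?thesis using that by blast
qed

lemma m_free_iff_no_closed_walk:
  "m_free m E \<longleftrightarrow> (\<forall>n\<in>{1..m}. \<forall>x. (x, x) \<notin> E ^^ n)"
proof
  assume "m_free m E"
  then show "\<forall>n\<in>{1..m}. \<forall>x. (x, x) \<notin> E ^^ n"
    unfolding m_free_def
    by (metis atLeastAtMost_iff closed_walk_imp_is_dcycle less_eq_Suc_le One_nat_def order_trans)
next
  assume no_closed_walk: "\<forall>n\<in>{1..m}. \<forall>x. (x, x) \<notin> E ^^ n"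
  show "m_free m E"
    unfolding m_free_def
  proof clarify
    fix vs assume "is_dcycle E vs" "length vs \<le> m"
    moreover from this have "1 \<le> length vs" by (simp add: is_dcycle_def Suc_le_eq)
    ultimately show False
      using no_closed_walk is_dcycle_imp_closed_walk by (metis atLeastAtMost_iff)
  qed
qed

lemma m_free_no_closed_walk:
  "m_free m E \<Longrightarrow> 1 \<le> n \<Longrightarrow> n \<le> m \<Longrightarrow> (x, x) \<notin> E ^^ n"
  by (simp add: m_free_iff_no_closed_walk)

lemma m_free_subset: "m_free m E \<Longrightarrow> F \<subseteq> E \<Longrightarrow> m_free m F"
  unfolding m_free_def is_dcycle_def by blast

lemma dacyclic_iff_acyclic: "dacyclic E \<longleftrightarrow> acyclic E"
proof
  show "acyclic E" if "dacyclic E"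
    using that unfolding dacyclic_def acyclic_def trancl_power
    by (metis closed_walk_imp_is_dcycle)
next
  show "dacyclic E" if "acyclic E"
    using that unfolding dacyclic_def acyclic_def trancl_power
    by (metis is_dcycle_imp_closed_walk is_dcycle_def length_greater_0_conv)
qed


subsection \<open>Reversing all edges\<close>

lemma relpow_converse: "(E\<inverse>) ^^ n = (E ^^ n)\<inverse>" for E :: "('a \<times> 'a) set"
proof (induction n)
  case (Suc n)
  have "(E\<inverse>) ^^ Suc n = (E O E ^^ n)\<inverse>" by (simp add: Suc converse_relcomp)
  then show ?case by (simp add: relpow_commute)
qed simp

lemma digraph_converse: "digraph V E \<Longrightarrow> digraph V (E\<inverse>)"
  by (auto simp: digraph_def)

lemma m_free_converse: "m_free m E \<Longrightarrow> m_free m (E\<inverse>)"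
  by (simp add: m_free_iff_no_closed_walk relpow_converse)

lemma at_dist_converse: "at_dist (E\<inverse>) k = (at_dist E k)\<inverse>"
  by (auto simp: at_dist_def relpow_converse)

lemma card_geodesic_triples_converse:
  "card (geodesic_triples (E\<inverse>) j k) = card (geodesic_triples E k j)"
  by (rule bij_betw_same_card[of "\<lambda>(u, w, z). (z, w, u)"],
      rule bij_betw_byWitness[where f' = "\<lambda>(u, w, z). (z, w, u)"])
     (auto simp: geodesic_triples_def at_dist_converse add.commute)

lemma sparse_cut_converse:
  assumes "sparse_cut c V (E\<inverse>) S"
  shows "sparse_cut c V E (V - S)"
proof -
  have "S \<subset> V" using assms by (simp add: sparse_cut_def)
  then have "cut_edges V E (V - S) = (cut_edges V (E\<inverse>) S)\<inverse>"
    and "cut_nonedges V E (V - S) = (cut_nonedges V (E\<inverse>) S)\<inverse>"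
    by (auto simp: cut_edges_def cut_nonedges_def)
  then show ?thesis using assms by (auto simp: sparse_cut_def)
qed


subsection \<open>Distances and geodesic triples\<close>

lemma at_dist_unique:
  "(x, y) \<in> at_dist E j \<Longrightarrow> (x, y) \<in> at_dist E k \<Longrightarrow> j = k"
  unfolding at_dist_def by (cases j k rule: linorder_cases) auto

lemma at_dist_imp_relpow: "(x, y) \<in> at_dist E k \<Longrightarrow> (x, y) \<in> E ^^ k"
  by (simp add: at_dist_def)

lemma relpow_imp_at_dist:
  assumes "(x, y) \<in> E ^^ n"
  obtains k where "k \<le> n" "(x, y) \<in> at_dist E k"
proof
  let ?k = "LEAST k. (x, y) \<in> E ^^ k"
  show "?k \<le> n" using assms by (rule Least_le)
  show "(x, y) \<in> at_dist E ?k"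
    using LeastI[of "\<lambda>k. (x, y) \<in> E ^^ k", OF assms] not_less_Least[of _ "\<lambda>k. (x, y) \<in> E ^^ k"]
    by (auto simp: at_dist_def)
qed

lemma at_dist_0: "at_dist E 0 = Id"
  by (auto simp: at_dist_def)

lemma at_dist_Suc_0: "at_dist E (Suc 0) = E - Id"
  by (auto simp: at_dist_def)

lemma at_dist_subset_Times:
  assumes "E \<subseteq> V \<times> V" "1 \<le> k"
  shows "at_dist E k \<subseteq> V \<times> V"
proof -
  have "at_dist E k \<subseteq> E ^^ k" by (auto simp: at_dist_def)
  also have "\<dots> \<subseteq> E\<^sup>+" using assms(2) by (auto simp: trancl_power Suc_le_eq)
  also have "\<dots> \<subseteq> V \<times> V" using assms(1) by (rule trancl_subset_Sigma)
  finally show ?thesis .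
qed

lemma at_dist_nonadjacent:
  assumes free: "m_free m E" and k: "2 \<le> k" "k < m" and dist: "(x, y) \<in> at_dist E k"
  shows "(x, y) \<notin> E" "(y, x) \<notin> E"
proof -
  have "1 < k" using k by simp
  then have "(x, y) \<notin> E ^^ 1" using dist unfolding at_dist_def by blast
  then show "(x, y) \<notin> E" by simp
  show "(y, x) \<notin> E"
  proof
    assume "(y, x) \<in> E"
    with dist have "(x, x) \<in> E ^^ Suc k" by (auto simp: at_dist_def)
    then show False using m_free_no_closed_walk[OF free, of "Suc k"] k by simp
  qed
qed

lemma geodesic_triples_subset_Times:
  assumes "E \<subseteq> V \<times> V" "1 \<le> j" "1 \<le> k"
  shows "geodesic_triples E j k \<subseteq> V \<times> V \<times> V"
  using at_dist_subset_Times[OF assms(1)] assms(2,3) unfolding geodesic_triples_def by blast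

lemma finite_geodesic_triples:
  assumes "digraph V E" "1 \<le> j" "1 \<le> k"
  shows "finite (geodesic_triples E j k)"
proof (rule finite_subset)
  show "geodesic_triples E j k \<subseteq> V \<times> V \<times> V" and "finite (V \<times> V \<times> V)"
    using assms geodesic_triples_subset_Times[of E V j k] by (simp_all add: digraph_def)
qed

lemma geodesic_triples_disjoint:
  "(j, k) \<noteq> (j', k') \<Longrightarrow> geodesic_triples E j k \<inter> geodesic_triples E j' k' = {}"
  by (auto simp: geodesic_triples_def dest: at_dist_unique)


subsection \<open>Averaging the cuts around out-balls\<close>

lemma centre_notin_punctured_out_ball: "w \<notin> punctured_out_ball E i w"
  by (force simp: punctured_out_ball_def at_dist_def)

lemma punctured_out_ball_subset:
  assumes "E \<subseteq> V \<times> V"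
  shows "punctured_out_ball E i w \<subseteq> V"
proof
  fix z assume "z \<in> punctured_out_ball E i w"
  then obtain k where "1 \<le> k" "(w, z) \<in> at_dist E k" by (auto simp: punctured_out_ball_def)
  then show "z \<in> V" using at_dist_subset_Times[OF assms] by blast
qed

lemma cut_edge_punctured_out_ball:
  assumes free: "m_free m E" and "i < m" and "(x, y) \<in> cut_edges V E (punctured_out_ball E i w)"
  shows "(w, x, y) \<in> geodesic_triples E i 1"
proof -
  have edge: "(x, y) \<in> E" and y: "y \<notin> punctured_out_ball E i w"
    using assms(3) by (auto simp: cut_edges_def)
  obtain k where k: "1 \<le> k" "k \<le> i" and wx: "(w, x) \<in> at_dist E k"
    using assms(3) by (auto simp: cut_edges_def punctured_out_ball_def)
  have walk: "(w, y) \<in> E ^^ Suc k" using at_dist_imp_relpow[OF wx] edge by auto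
  then obtain l where l: "l \<le> Suc k" and wy: "(w, y) \<in> at_dist E l" by (rule relpow_imp_at_dist)
  have "w \<noteq> y"
    using walk m_free_no_closed_walk[OF free, of "Suc k"] k \<open>i < m\<close> by auto
  then have "l \<noteq> 0" using wy by (intro notI) (simp add: at_dist_0)
  then have "i < l" using y wy by (force simp: punctured_out_ball_def)
  then have "k = i" "l = i + 1" using l k by auto
  moreover have "(x, y) \<in> at_dist E 1"
    using edge m_free_no_closed_walk[OF free, of 1] \<open>i < m\<close> by (auto simp: at_dist_Suc_0)
  ultimately show ?thesis using wx wy by (simp add: geodesic_triples_def)
qed

lemma geodesic_triple_cut_nonedge:
  assumes G: "digraph V E" and free: "m_free m E"
    and "1 \<le> j" "1 \<le> k" "k \<le> i" "i + j \<le> m" "j + k < m"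
    and triple: "(u, w, z) \<in> geodesic_triples E j k"
  shows "(z, u) \<in> cut_nonedges V E (punctured_out_ball E i w)"
proof -
  have uw: "(u, w) \<in> at_dist E j" and wz: "(w, z) \<in> at_dist E k" and uz: "(u, z) \<in> at_dist E (j + k)"
    using triple by (auto simp: geodesic_triples_def)
  have "z \<in> punctured_out_ball E i w"
    using wz assms(4,5) by (auto simp: punctured_out_ball_def)
  moreover have "u \<notin> punctured_out_ball E i w"
  proof
    assume "u \<in> punctured_out_ball E i w"
    then obtain l where "l \<le> i" and wu: "(w, u) \<in> at_dist E l"
      by (auto simp: punctured_out_ball_def)
    have "(u, u) \<in> E ^^ (j + l)"
      using at_dist_imp_relpow[OF uw] at_dist_imp_relpow[OF wu] by (rule relpow_trans)
    then show False
      using m_free_no_closed_walk[OF free, of "j + l"] \<open>l \<le> i\<close> assms(3,6) by simp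
  qed
  moreover have "u \<in> V"
    using geodesic_triples_subset_Times[of E V j k] G assms(3,4) triple by (auto simp: digraph_def)
  moreover have "(u, z) \<notin> E" "(z, u) \<notin> E"
    using at_dist_nonadjacent[OF free _ _ uz] assms(3,4,7) by auto
  ultimately show ?thesis by (simp add: cut_nonedges_def)
qed

lemma sum_card_cut_edges_le:
  assumes G: "digraph V E" and free: "m_free m E" and i: "1 \<le> i" "i < m"
  shows "(\<Sum>w\<in>V. card (cut_edges V E (punctured_out_ball E i w))) \<le> card (geodesic_triples E i 1)"
proof -
  have "finite V" using G by (simp add: digraph_def)
  then have "(\<Sum>w\<in>V. card (cut_edges V E (punctured_out_ball E i w)))
      = card (SIGMA w:V. cut_edges V E (punctured_out_ball E i w))"
    using digraph_finite_edges[OF G] by (simp add: cut_edges_def)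
  also have "\<dots> \<le> card (geodesic_triples E i 1)"
  proof (rule card_mono)
    show "finite (geodesic_triples E i 1)" using finite_geodesic_triples[OF G i(1)] by simp
    show "(SIGMA w:V. cut_edges V E (punctured_out_ball E i w)) \<subseteq> geodesic_triples E i 1"
      using cut_edge_punctured_out_ball[OF free i(2)] by clarify
  qed
  finally show ?thesis .
qed

lemma sum_card_geodesic_triples_le:
  assumes G: "digraph V E" and free: "m_free m E"
    and "finite P" and P: "P \<subseteq> {(j, k). 1 \<le> j \<and> 1 \<le> k \<and> k \<le> i \<and> i + j \<le> m \<and> j + k < m}"
  shows "(\<Sum>(j, k)\<in>P. card (geodesic_triples E j k))
    \<le> (\<Sum>w\<in>V. card (cut_nonedges V E (punctured_out_ball E i w)))"
proof -
  let ?triples = "\<lambda>(j, k). geodesic_triples E j k"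
  let ?nonedges = "\<lambda>w. cut_nonedges V E (punctured_out_ball E i w)"
  have finV: "finite V" and EV: "E \<subseteq> V \<times> V" using G by (auto simp: digraph_def)
  have fin_nonedges: "finite (?nonedges w)" for w
  proof (rule finite_subset)
    show "?nonedges w \<subseteq> V \<times> V" and "finite (V \<times> V)"
      using finV punctured_out_ball_subset[OF EV] by (auto simp: cut_nonedges_def)
  qed
  have "(\<Sum>(j, k)\<in>P. card (geodesic_triples E j k)) = (\<Sum>p\<in>P. card (?triples p))"
    by (simp add: case_prod_unfold)
  also have "\<dots> = card (\<Union>p\<in>P. ?triples p)"
  proof (rule card_UN_disjoint[symmetric])
    show "\<forall>p\<in>P. finite (?triples p)" using P finite_geodesic_triples[OF G] by auto
    show "\<forall>p\<in>P. \<forall>q\<in>P. p \<noteq> q \<longrightarrow> ?triples p \<inter> ?triples q = {}"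
      by (simp add: split_paired_all geodesic_triples_disjoint)
  qed fact
  also have "\<dots> \<le> card (SIGMA w:V. ?nonedges w)"
  proof (rule card_inj_on_le[where f = "\<lambda>(u, w, z). (w, z, u)"])
    show "inj_on (\<lambda>(u, w, z). (w, z, u)) (\<Union>p\<in>P. ?triples p)" by (auto simp: inj_on_def)
    show "(\<lambda>(u, w, z). (w, z, u)) ` (\<Union>p\<in>P. ?triples p) \<subseteq> (SIGMA w:V. ?nonedges w)"
    proof clarify
      fix j k u w z assume "(j, k) \<in> P" and triple: "(u, w, z) \<in> geodesic_triples E j k"
      then have jk: "1 \<le> j" "1 \<le> k" "k \<le> i" "i + j \<le> m" "j + k < m" using P by auto
      have "w \<in> V" using geodesic_triples_subset_Times[OF EV jk(1,2)] triple by blast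
      then show "w \<in> V \<and> (z, u) \<in> ?nonedges w"
        using geodesic_triple_cut_nonedge[OF G free jk triple] by simp
    qed
    show "finite (SIGMA w:V. ?nonedges w)" using finV fin_nonedges by blast
  qed
  also have "\<dots> = (\<Sum>w\<in>V. card (?nonedges w))"
    using finV fin_nonedges by simp
  finally show ?thesis .
qed


subsection \<open>Existence of sparse cuts\<close>

lemma exists_le_if_sum_le:
  fixes f g :: "'a \<Rightarrow> 'b::{linorder, strict_ordered_comm_monoid_add}"
  assumes "finite A" "A \<noteq> {}" "sum f A \<le> sum g A"
  shows "\<exists>x\<in>A. f x \<le> g x"
proof (rule ccontr)
  assume "\<not> ?thesis"
  then have "sum g A < sum f A" using assms(1,2) by (intro sum_strict_mono) auto
  then show False using assms(3) by simp
qed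

lemma sum_cut_punctured_out_balls_le:
  assumes G: "digraph V E" and free: "m_free m E" and i: "1 \<le> i" "i \<le> m - 2"
    and rarest: "\<And>j k. (j, k) \<in> unit_leg_types (m - 2) \<Longrightarrow>
      card (geodesic_triples E i 1) \<le> card (geodesic_triples E j k)"
  shows "(\<Sum>w\<in>V. (m - 2) * card (cut_edges V E (punctured_out_ball E i w)))
    \<le> (\<Sum>w\<in>V. card (cut_nonedges V E (punctured_out_ball E i w)))"
proof -
  define P where "P = {1..m - 1 - i} \<times> {1::nat} \<union> {1::nat} \<times> {2..i}"
  have "card P = (m - 1 - i) + (i - 1)"
    unfolding P_def by (subst card_Un_disjoint) auto
  then have card_P: "card P = m - 2" using i by simp
  have P_types: "P \<subseteq> unit_leg_types (m - 2)" using i by (auto simp: P_def unit_leg_types_def)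
  have "(\<Sum>w\<in>V. (m - 2) * card (cut_edges V E (punctured_out_ball E i w)))
      = (m - 2) * (\<Sum>w\<in>V. card (cut_edges V E (punctured_out_ball E i w)))"
    by (simp add: sum_distrib_left)
  also have "\<dots> \<le> (m - 2) * card (geodesic_triples E i 1)"
    using i by (intro mult_left_mono sum_card_cut_edges_le[OF G free]) auto
  also have "\<dots> = (\<Sum>(j, k)\<in>P. card (geodesic_triples E i 1))"
    by (simp add: card_P)
  also have "\<dots> \<le> (\<Sum>(j, k)\<in>P. card (geodesic_triples E j k))"
    by (intro sum_mono) (use rarest P_types in fastforce)
  also have "\<dots> \<le> (\<Sum>w\<in>V. card (cut_nonedges V E (punctured_out_ball E i w)))"
    using i by (intro sum_card_geodesic_triples_le[OF G free]) (auto simp: P_def)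
  finally show ?thesis .
qed

lemma sparse_cut_if_rarest:
  assumes G: "digraph V E" and free: "m_free m E" and V: "2 \<le> card V"
    and i: "1 \<le> i" "i \<le> m - 2"
    and rarest: "\<And>j k. (j, k) \<in> unit_leg_types (m - 2) \<Longrightarrow>
      card (geodesic_triples E i 1) \<le> card (geodesic_triples E j k)"
  shows "\<exists>S. sparse_cut (m - 2) V E S"
proof (cases "\<exists>w\<in>V. E `` {w} = {}")
  case True
  then obtain w where "w \<in> V" and sink: "E `` {w} = {}" by blast
  moreover have "V \<noteq> {w}" using V by auto
  moreover have "cut_edges V E {w} = {}" using sink by (auto simp: cut_edges_def)
  ultimately have "sparse_cut (m - 2) V E {w}" by (auto simp: sparse_cut_def)
  then show ?thesis ..
next
  case False
  let ?S = "punctured_out_ball E i"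
  have EV: "E \<subseteq> V \<times> V" and "finite V" and "V \<noteq> {}" using G V by (auto simp: digraph_def)
  then obtain w where "w \<in> V"
    and cut: "(m - 2) * card (cut_edges V E (?S w)) \<le> card (cut_nonedges V E (?S w))"
    using exists_le_if_sum_le[OF _ _ sum_cut_punctured_out_balls_le[OF G free i rarest]] by blast
  obtain z where "(w, z) \<in> E" using False \<open>w \<in> V\<close> by blast
  then have "(w, z) \<in> at_dist E 1" using G by (auto simp: digraph_def at_dist_Suc_0)
  then have "z \<in> ?S w" using i(1) by (auto simp: punctured_out_ball_def)
  moreover have "?S w \<subset> V"
    using punctured_out_ball_subset[OF EV, of i w] centre_notin_punctured_out_ball[of w E i]
      \<open>w \<in> V\<close>
    by blast
  ultimately have "sparse_cut (m - 2) V E (?S w)" using cut by (auto simp: sparse_cut_def)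
  then show ?thesis ..
qed

lemma sparse_cut_exists:
  assumes G: "digraph V E" and free: "m_free m E" and "3 \<le> m" and V: "2 \<le> card V"
  shows "\<exists>S. sparse_cut (m - 2) V E S"
proof -
  let ?T = "unit_leg_types (m - 2)"
  define count where "count = (\<lambda>(j, k). card (geodesic_triples E j k))"
  have "finite ?T" "?T \<noteq> {}" using \<open>3 \<le> m\<close> by (auto simp: unit_leg_types_def)
  then obtain p where "p \<in> ?T" and rarest: "\<And>q. q \<in> ?T \<Longrightarrow> count p \<le> count q"
    using arg_min_if_finite[of ?T count] by (metis linorder_not_le)
  then consider (leg_right) i where "p = (i, 1)" "i \<in> {1..m - 2}"
    | (leg_left) i where "p = (1, i)" "i \<in> {1..m - 2}"
    by (auto simp: unit_leg_types_def)
  then show ?thesis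
  proof cases
    case leg_right
    then show ?thesis
      using rarest by (intro sparse_cut_if_rarest[OF G free V, of i]) (auto simp: count_def)
  next
    case leg_left
    have "card (geodesic_triples (E\<inverse>) i 1) \<le> card (geodesic_triples (E\<inverse>) j k)"
      if "(j, k) \<in> ?T" for j k
      using rarest[of "(k, j)"] that leg_left
      by (auto simp: card_geodesic_triples_converse count_def unit_leg_types_def)
    then obtain S where "sparse_cut (m - 2) V (E\<inverse>) S"
      using sparse_cut_if_rarest[OF digraph_converse[OF G] m_free_converse[OF free] V, of i] leg_left
      by auto
    then show ?thesis using sparse_cut_converse by blast
  qed
qed


subsection \<open>From sparse cuts to feedback arc sets\<close>

lemma trancl_Restr_if_closed:
  assumes "(x, y) \<in> R\<^sup>+" "R `` S \<subseteq> S" "x \<in> S"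
  shows "(x, y) \<in> (Restr R S)\<^sup>+ \<and> y \<in> S"
  using assms(1)
proof (induction rule: trancl_induct)
  case (base y)
  then show ?case using assms(2,3) by blast
next
  case (step y z)
  then have "(y, z) \<in> Restr R S" using assms(2) by blast
  then show ?case using step.IH by (blast intro: trancl_into_trancl)
qed

lemma acyclic_if_closed:
  assumes closed: "R `` S \<subseteq> S"
    and inside: "acyclic (Restr R S)" and outside: "acyclic (Restr R (- S))"
  shows "acyclic R"
  unfolding acyclic_def
proof clarify
  fix x assume cycle: "(x, x) \<in> R\<^sup>+"
  show False
  proof (cases "x \<in> S")
    case True
    then show False
      using trancl_Restr_if_closed[OF cycle closed] inside by (simp add: acyclic_def)
  next
    case False
    have "(x, x) \<in> (R\<inverse>)\<^sup>+" using cycle by (simp add: trancl_converse)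
    moreover have "R\<inverse> `` (- S) \<subseteq> - S" using closed by blast
    ultimately have "(x, x) \<in> (Restr (R\<inverse>) (- S))\<^sup>+"
      using trancl_Restr_if_closed[of x x "R\<inverse>" "- S"] False by simp
    moreover have "Restr (R\<inverse>) (- S) = (Restr R (- S))\<inverse>" by blast
    ultimately show False using outside by (simp add: acyclic_def trancl_converse)
  qed
qed

lemma gamma_eq_card: "gamma V E = card (nonadjacent_pairs V E)"
  by (simp add: gamma_def nonadjacent_pairs_def)

lemma nonadjacent_pairs_cut:
  assumes "S \<subseteq> V"
  shows "nonadjacent_pairs V E = nonadjacent_pairs S E \<union> nonadjacent_pairs (V - S) E
    \<union> (\<lambda>(x, y). {x, y}) ` cut_nonedges V E S" (is "_ = ?A \<union> ?B \<union> ?C")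
proof (intro equalityI subsetI)
  fix X assume "X \<in> nonadjacent_pairs V E"
  then obtain a b where X: "X = {a, b}" and ab: "a \<in> V" "b \<in> V" "a \<noteq> b" "(a, b) \<notin> E" "(b, a) \<notin> E"
    unfolding nonadjacent_pairs_def by blast
  consider (inside) "a \<in> S" "b \<in> S" | (outside) "a \<notin> S" "b \<notin> S"
    | (across) "a \<in> S" "b \<notin> S" | (across_swapped) "a \<notin> S" "b \<in> S"
    by blast
  then show "X \<in> ?A \<union> ?B \<union> ?C"
  proof cases
    case inside
    then have "X \<in> ?A" unfolding nonadjacent_pairs_def using X ab by blast
    then show ?thesis by blast
  next
    case outside
    then have "X \<in> ?B" unfolding nonadjacent_pairs_def using X ab by blast
    then show ?thesis by blast
  next
    case across
    then have "X \<in> ?C" using X ab by (force simp: cut_nonedges_def)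
    then show ?thesis by blast
  next
    case across_swapped
    then have "X \<in> ?C" using X ab by (force simp: cut_nonedges_def insert_commute)
    then show ?thesis by blast
  qed
next
  fix X assume "X \<in> ?A \<union> ?B \<union> ?C"
  then consider "X \<in> ?A" | "X \<in> ?B" | "X \<in> ?C" by blast
  then show "X \<in> nonadjacent_pairs V E"
    using assms unfolding nonadjacent_pairs_def cut_nonedges_def by cases (blast, blast, auto)
qed

lemma gamma_cut:
  assumes "finite V" and S: "S \<subseteq> V"
  shows "gamma V E = gamma S E + gamma (V - S) E + card (cut_nonedges V E S)"
proof -
  define A B C where "A = nonadjacent_pairs S E" and "B = nonadjacent_pairs (V - S) E"
    and "C = (\<lambda>(x, y). {x, y}) ` cut_nonedges V E S"
  have pairs: "nonadjacent_pairs V E = A \<union> B \<union> C"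
    unfolding A_def B_def C_def using S by (rule nonadjacent_pairs_cut)
  have "nonadjacent_pairs V E \<subseteq> Pow V" by (auto simp: nonadjacent_pairs_def)
  then have finite: "finite A" "finite B" "finite C"
    using \<open>finite V\<close> by (auto simp: pairs intro: finite_subset)
  have inside: "X \<subseteq> S \<and> X \<noteq> {}" if "X \<in> A" for X
    using that by (auto simp: A_def nonadjacent_pairs_def)
  have outside: "X \<inter> S = {} \<and> X \<noteq> {}" if "X \<in> B" for X
    using that by (auto simp: B_def nonadjacent_pairs_def)
  have across: "\<not> X \<subseteq> S \<and> X \<inter> S \<noteq> {}" if "X \<in> C" for X
    using that by (auto simp: C_def cut_nonedges_def)
  have "A \<inter> B = {}" "(A \<union> B) \<inter> C = {}" using inside outside across by blast+
  then have "gamma V E = card A + card B + card C"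
    using finite by (simp add: gamma_eq_card card_Un_disjoint pairs)
  moreover have "inj_on (\<lambda>(x, y). {x, y}) (cut_nonedges V E S)"
    by (auto simp: inj_on_def cut_nonedges_def doubleton_eq_iff)
  then have "card C = card (cut_nonedges V E S)" unfolding C_def by (rule card_image)
  ultimately show ?thesis
    by (simp add: gamma_eq_card A_def B_def)
qed

lemma sparse_cut_Restr: "sparse_cut c W (Restr E W) S \<longleftrightarrow> sparse_cut c W E S"
proof (cases "S \<subseteq> W")
  case True
  then have "cut_edges W (Restr E W) S = cut_edges W E S"
    and "cut_nonedges W (Restr E W) S = cut_nonedges W E S"
    by (auto simp: cut_edges_def cut_nonedges_def)
  then show ?thesis by (simp add: sparse_cut_def)
qed (auto simp: sparse_cut_def)

lemma acyclic_remove_cut: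
  assumes X: "acyclic (Restr E S - X)" and Y: "acyclic (Restr E (W - S) - Y)"
  shows "acyclic (Restr E W - (X \<union> Y \<union> cut_edges W E S))" (is "acyclic ?R")
proof (rule acyclic_if_closed)
  show "?R `` S \<subseteq> S" by (auto simp: cut_edges_def)
  show "acyclic (Restr ?R S)" using X by (rule acyclic_subset) blast
  show "acyclic (Restr ?R (- S))" using Y by (rule acyclic_subset) blast
qed

lemma card_feedback_union_le:
  assumes "finite W" and S: "sparse_cut c W E S"
    and X: "c * card X \<le> gamma S E" and Y: "c * card Y \<le> gamma (W - S) E"
  shows "c * card (X \<union> Y \<union> cut_edges W E S) \<le> gamma W E"
proof -
  have "card (X \<union> Y \<union> cut_edges W E S) \<le> card (X \<union> Y) + card (cut_edges W E S)"
    by (rule card_Un_le)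
  also have "\<dots> \<le> card X + card Y + card (cut_edges W E S)"
    by (intro add_right_mono card_Un_le)
  finally have "c * card (X \<union> Y \<union> cut_edges W E S) \<le> c * (card X + card Y + card (cut_edges W E S))"
    by (rule mult_le_mono2)
  also have "\<dots> \<le> gamma S E + gamma (W - S) E + card (cut_nonedges W E S)"
    using S X Y by (simp add: sparse_cut_def distrib_left)
  also have "\<dots> = gamma W E"
    using gamma_cut[OF \<open>finite W\<close>, of S E] S by (auto simp: sparse_cut_def)
  finally show ?thesis .
qed

lemma feedback_arc_set_if_sparse_cuts:
  assumes "finite W" and loopless: "\<And>v. (v, v) \<notin> E"
    and cuts: "\<And>U. U \<subseteq> W \<Longrightarrow> 2 \<le> card U \<Longrightarrow> \<exists>S. sparse_cut c U E S"
  shows "\<exists>X\<subseteq>E. acyclic (Restr E W - X) \<and> c * card X \<le> gamma W E"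
  using assms(1) cuts
proof (induction W rule: finite_psubset_induct)
  case (psubset W)
  show ?case
  proof (cases "2 \<le> card W")
    case False
    then have "card W \<le> Suc 0" by simp
    then have "\<forall>x\<in>W. \<forall>y\<in>W. x = y"
      using psubset.hyps by (simp add: card_le_Suc0_iff_eq)
    then have "(x, y) \<notin> Restr E W" for x y
      using loopless by (metis IntE mem_Sigma_iff)
    then have "Restr E W = {}" by auto
    then show ?thesis by (intro exI[of _ "{}"]) (simp add: acyclic_def)
  next
    case True
    then obtain S where S: "sparse_cut c W E S" using psubset.prems by blast
    then have "S \<subset> W" "W - S \<subset> W" by (auto simp: sparse_cut_def)
    have feedback: "\<exists>X\<subseteq>E. acyclic (Restr E U - X) \<and> c * card X \<le> gamma U E" if "U \<subset> W" for U
    proof (rule psubset.IH[OF that])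
      show "\<exists>S. sparse_cut c T E S" if "T \<subseteq> U" "2 \<le> card T" for T
        using \<open>U \<subset> W\<close> that by (intro psubset.prems) auto
    qed
    obtain X where X: "X \<subseteq> E" "acyclic (Restr E S - X)" "c * card X \<le> gamma S E"
      using feedback[OF \<open>S \<subset> W\<close>] by (elim exE conjE)
    obtain Y where Y: "Y \<subseteq> E" "acyclic (Restr E (W - S) - Y)" "c * card Y \<le> gamma (W - S) E"
      using feedback[OF \<open>W - S \<subset> W\<close>] by (elim exE conjE)
    show ?thesis
    proof (intro exI conjI)
      show "X \<union> Y \<union> cut_edges W E S \<subseteq> E" using X(1) Y(1) by (auto simp: cut_edges_def)
      show "acyclic (Restr E W - (X \<union> Y \<union> cut_edges W E S))"
        using X(2) Y(2) by (rule acyclic_remove_cut)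
      show "c * card (X \<union> Y \<union> cut_edges W E S) \<le> gamma W E"
        using psubset.hyps S X(3) Y(3) by (rule card_feedback_union_le)
    qed
  qed
qed

lemma m_free_feedback_arc_set:
  assumes G: "digraph V E" and free: "m_free m E" and "3 \<le> m"
  obtains X where "X \<subseteq> E" "acyclic (E - X)" "(m - 2) * card X \<le> gamma V E"
proof -
  have "finite V" and EV: "Restr E V = E" and loopless: "\<And>v. (v, v) \<notin> E"
    using G by (auto simp: digraph_def)
  have "\<exists>S. sparse_cut (m - 2) W E S" if W: "W \<subseteq> V" "2 \<le> card W" for W
  proof -
    have "digraph W (Restr E W)"
      using G W(1) by (auto simp: digraph_def intro: finite_subset)
    moreover have "m_free m (Restr E W)" using free by (rule m_free_subset) simp
    ultimately show ?thesis
      using sparse_cut_exists \<open>3 \<le> m\<close> W(2) by (metis sparse_cut_Restr)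
  qed
  then obtain X where "X \<subseteq> E" "acyclic (Restr E V - X)" "(m - 2) * card X \<le> gamma V E"
    using feedback_arc_set_if_sparse_cuts[OF \<open>finite V\<close> loopless] by blast
  then show ?thesis using that EV by simp
qed

lemma beta_le_card:
  assumes "finite E" "X \<subseteq> E" "acyclic (E - X)"
  shows "beta E \<le> card X"
  unfolding beta_def
proof (rule Min_le)
  show "finite {card X | X. X \<subseteq> E \<and> dacyclic (E - X)}" using assms(1) by simp
  show "card X \<in> {card X | X. X \<subseteq> E \<and> dacyclic (E - X)}"
    using assms(2,3) by (auto simp: dacyclic_iff_acyclic)
qed

theorem theorem1p4:
  fixes V :: "'a set" and E :: "('a \<times> 'a) set" and m :: nat
  assumes "m \<ge> 4" and "digraph V E" and "m_free m E"
  shows "real (beta E) \<le> real (gamma V E) / real (m - 2)"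
proof -
  obtain X where X: "X \<subseteq> E" "acyclic (E - X)" "(m - 2) * card X \<le> gamma V E"
    using m_free_feedback_arc_set[OF assms(2,3)] assms(1) by auto
  have "(m - 2) * beta E \<le> (m - 2) * card X"
    using beta_le_card[OF digraph_finite_edges[OF assms(2)] X(1,2)] by (rule mult_le_mono2)
  also have "\<dots> \<le> gamma V E" by (rule X(3))
  finally have "real (m - 2) * real (beta E) \<le> real (gamma V E)"
    by (metis of_nat_le_iff of_nat_mult)
  then show ?thesis
    using assms(1) by (simp add: pos_le_divide_eq mult.commute)
qed

end
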